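(* For $q,s\in\mathbb{H}$ with $|q|<|s|$ we have $$\sum_{k=0}^{1}q_0^kF_L(s,q)(-1)^{k+1}s^{1-k}=2\sum_{n=1}^{\infty}\Big(nq^{n-1}+\sum_{j=1}^{n}q^{n-j}\bar q^{\,j-1}\Big)s^{-1-n}=2\sum_{n=1}^{\infty}\sum_{j=0}^{1}n\,q_0^j(-1)^j(n+1-2j)\,Q_{n-1-j}(q,\bar q)\,s^{-1-n},$$ and $$\sum_{k=0}^{1}s^{1-k}(-1)^{k+1}F_R(s,q)q_0^k=2\sum_{n=1}^{\infty}s^{-1-n}\Big(nq^{n-1}+\sum_{k=1}^{n}q^{n-k}\bar q^{\,k-1}\Big)=2\sum_{n=1}^{\infty}\sum_{j=0}^{1}n\,s^{-1-n}q_0^j(-1)^j(n+1-2j)\,Q_{n-1-j}(q,\bar q).$$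
   Context: $\mathbb{H}$ is the skew field of quaternions $q=q_0+q_1e_1+q_2e_2+q_3e_3$, $q_i\in\mathbb{R}$, with the usual imaginary units $e_1,e_2,e_3$; $\operatorname{Re}(q)=q_0$, $\bar q=q_0-q_1e_1-q_2e_2-q_3e_3$, $|q|=\sqrt{q\bar q}$. The $\mathcal{F}$-kernels are $F_L(s,q)=-4(s-\bar q)(s^2-2\operatorname{Re}(q)s+|q|^2)^{-2}$ and $F_R(s,q)=-4(s^2-2\operatorname{Re}(q)s+|q|^2)^{-2}(s-\bar q)$. For $\ell\ge 0$ the quaternionic Clifford-Appell polynomials are $$Q_\ell(q,\bar q)=\frac{2}{(\ell+1)(\ell+2)}\sum_{j=0}^{\ell}(\ell-j+1)q^{\ell-j}\bar q^{\,j}.$$ By convention $Q_{-1}(q,\bar q):=0$ (this only occurs for $n=1$, $j=1$, where its coefficient $n+1-2j$ is zero). *)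

theory Defs
  imports "HOL-Analysis.Analysis"
begin

section \<open>The normed division algebra of quaternions\<close>

text \<open>\<open>Quat a b c d\<close> is the quaternion $a + b e_1 + c e_2 + d e_3$,
  where $e_1 e_2 = e_3$, $e_2 e_3 = e_1$, $e_3 e_1 = e_2$.\<close>

codatatype quat = Quat (qRe: real) (qIm1: real) (qIm2: real) (qIm3: real)

lemma quat_eqI [intro?]:
  "\<lbrakk>qRe x = qRe y; qIm1 x = qIm1 y; qIm2 x = qIm2 y; qIm3 x = qIm3 y\<rbrakk> \<Longrightarrow> x = y"
  by (rule quat.expand) simp

lemma quat_eq_iff:
  "x = y \<longleftrightarrow> qRe x = qRe y \<and> qIm1 x = qIm1 y \<and> qIm2 x = qIm2 y \<and> qIm3 x = qIm3 y"
  by (auto intro: quat.expand)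

instantiation quat :: ab_group_add
begin

primcorec zero_quat where
  "qRe 0 = 0" | "qIm1 0 = 0" | "qIm2 0 = 0" | "qIm3 0 = 0"

primcorec plus_quat where
  "qRe (x + y) = qRe x + qRe y"
| "qIm1 (x + y) = qIm1 x + qIm1 y"
| "qIm2 (x + y) = qIm2 x + qIm2 y"
| "qIm3 (x + y) = qIm3 x + qIm3 y"

primcorec uminus_quat where
  "qRe (- x) = - qRe x"
| "qIm1 (- x) = - qIm1 x"
| "qIm2 (- x) = - qIm2 x"
| "qIm3 (- x) = - qIm3 x"

primcorec minus_quat where
  "qRe (x - y) = qRe x - qRe y"
| "qIm1 (x - y) = qIm1 x - qIm1 y"
| "qIm2 (x - y) = qIm2 x - qIm2 y"
| "qIm3 (x - y) = qIm3 x - qIm3 y"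

instance
  by standard (simp_all add: quat_eq_iff)

end

instantiation quat :: ring_1
begin

primcorec one_quat where
  "qRe 1 = 1" | "qIm1 1 = 0" | "qIm2 1 = 0" | "qIm3 1 = 0"

primcorec times_quat where
  "qRe (x * y) = qRe x * qRe y - qIm1 x * qIm1 y - qIm2 x * qIm2 y - qIm3 x * qIm3 y"
| "qIm1 (x * y) = qRe x * qIm1 y + qIm1 x * qRe y + qIm2 x * qIm3 y - qIm3 x * qIm2 y"
| "qIm2 (x * y) = qRe x * qIm2 y - qIm1 x * qIm3 y + qIm2 x * qRe y + qIm3 x * qIm1 y"
| "qIm3 (x * y) = qRe x * qIm3 y + qIm1 x * qIm2 y - qIm2 x * qIm1 y + qIm3 x * qRe y"

instance
  by standard (simp_all add: quat_eq_iff algebra_simps)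

end

instantiation quat :: real_algebra_1
begin

primcorec scaleR_quat where
  "qRe (scaleR r x) = r * qRe x"
| "qIm1 (scaleR r x) = r * qIm1 x"
| "qIm2 (scaleR r x) = r * qIm2 x"
| "qIm3 (scaleR r x) = r * qIm3 x"

instance
  by standard (simp_all add: quat_eq_iff algebra_simps)

end

primcorec qcnj :: "quat \<Rightarrow> quat" where
  "qRe (qcnj x) = qRe x"
| "qIm1 (qcnj x) = - qIm1 x"
| "qIm2 (qcnj x) = - qIm2 x"
| "qIm3 (qcnj x) = - qIm3 x"

lemma qRe_of_real [simp]: "qRe (of_real r) = r"
  and qIm1_of_real [simp]: "qIm1 (of_real r) = 0"
  and qIm2_of_real [simp]: "qIm2 (of_real r) = 0"
  and qIm3_of_real [simp]: "qIm3 (of_real r) = 0"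
  by (simp_all add: of_real_def)

lemma quat_norm_sum_eq_0_iff:
  "(qRe x)\<^sup>2 + (qIm1 x)\<^sup>2 + (qIm2 x)\<^sup>2 + (qIm3 x)\<^sup>2 = 0 \<longleftrightarrow> x = 0"
  by (simp add: quat_eq_iff add_nonneg_eq_0_iff)

instantiation quat :: real_normed_div_algebra
begin

definition norm_quat_def:
  "norm x = sqrt ((qRe x)\<^sup>2 + (qIm1 x)\<^sup>2 + (qIm2 x)\<^sup>2 + (qIm3 x)\<^sup>2)"

definition sgn_quat_def: "sgn x = x /\<^sub>R norm (x :: quat)"

definition dist_quat_def: "dist x y = norm (x - y :: quat)"

definition uniformity_quat_def [code del]:
  "(uniformity :: (quat \<times> quat) filter) = (INF e\<in>{0 <..}. principal {(x, y). dist x y < e})"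

definition open_quat_def [code del]:
  "open (U :: quat set) \<longleftrightarrow> (\<forall>x\<in>U. eventually (\<lambda>(x', y). x' = x \<longrightarrow> y \<in> U) uniformity)"

definition inverse_quat_def:
  "inverse x =
    qcnj x /\<^sub>R ((qRe x)\<^sup>2 + (qIm1 x)\<^sup>2 + (qIm2 x)\<^sup>2 + (qIm3 x)\<^sup>2)"

definition divide_quat_def: "x div (y :: quat) = x * inverse y"

instance
proof
  fix r :: real and x y :: quat
  have tuple: "norm z = norm (qRe z, qIm1 z, qIm2 z, qIm3 z)" for z
    by (simp add: norm_quat_def norm_Pair add.assoc)
  show "norm x = 0 \<longleftrightarrow> x = 0"
    by (simp add: norm_quat_def quat_norm_sum_eq_0_iff)
  show "norm (x + y) \<le> norm x + norm y"
    using norm_triangle_ineq[of "(qRe x, qIm1 x, qIm2 x, qIm3 x)" "(qRe y, qIm1 y, qIm2 y, qIm3 y)"]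
    by (simp add: tuple)
  show "norm (r *\<^sub>R x) = \<bar>r\<bar> * norm x"
    using norm_scaleR[of r "(qRe x, qIm1 x, qIm2 x, qIm3 x)"]
    by (simp add: tuple)
  show "norm (x * y) = norm x * norm y"
    by (simp add: norm_quat_def real_sqrt_mult [symmetric] power2_eq_square algebra_simps)
  show "inverse (0 :: quat) = 0"
    by (simp add: inverse_quat_def)
  show "inverse x * x = 1" and "x * inverse x = 1" if "x \<noteq> 0"
  proof -
    define N where "N = (qRe x)\<^sup>2 + (qIm1 x)\<^sup>2 + (qIm2 x)\<^sup>2 + (qIm3 x)\<^sup>2"
    have N: "N \<noteq> 0"
      using that by (simp add: N_def quat_norm_sum_eq_0_iff)
    have "qcnj x * x = N *\<^sub>R 1" "x * qcnj x = N *\<^sub>R 1"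
      by (simp_all add: quat_eq_iff N_def power2_eq_square)
    moreover have "inverse x = qcnj x /\<^sub>R N"
      by (simp add: inverse_quat_def N_def)
    ultimately show "inverse x * x = 1" "x * inverse x = 1"
      using N by simp_all
  qed
qed (rule sgn_quat_def dist_quat_def open_quat_def uniformity_quat_def divide_quat_def)+

end

lemma quat_mult_qcnj: "x * qcnj x = of_real ((norm x)\<^sup>2)"
  by (simp add: quat_eq_iff norm_quat_def power2_eq_square real_sqrt_mult_self)

lemma norm_quat_eq_sqrt_mult_qcnj: "norm x = sqrt (qRe (x * qcnj x))"
  by (simp add: quat_mult_qcnj del: of_real_power)


section \<open>The kernels and the Clifford-Appell polynomials\<close>

definition F_L :: "quat \<Rightarrow> quat \<Rightarrow> quat" where
  "F_L s q = - 4 * (s - qcnj q)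
     * (s ^ 2 - 2 * of_real (qRe q) * s + of_real ((norm q)\<^sup>2)) powi (-2)"

definition F_R :: "quat \<Rightarrow> quat \<Rightarrow> quat" where
  "F_R s q = - 4 * (s ^ 2 - 2 * of_real (qRe q) * s + of_real ((norm q)\<^sup>2)) powi (-2)
     * (s - qcnj q)"

text \<open>\<open>Clifford_Appell l q\<close> is $Q_l(q, \bar q)$. The degree is an integer so that the
  convention $Q_{-1} = 0$ can be stated.\<close>

definition Clifford_Appell :: "int \<Rightarrow> quat \<Rightarrow> quat" where
  "Clifford_Appell l q =
     (if l < 0 then 0
      else of_real (2 / ((of_int l + 1) * (of_int l + 2)))
         * (\<Sum>j = 0..nat l. of_nat (nat l - j + 1) * q ^ (nat l - j) * qcnj q ^ j))"

end

theory Submission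
  imports Defs
begin

text \<open>
  Write \<open>a = q\<close>, \<open>b\<close> for the conjugate of \<open>q\<close>, \<open>t\<close> for the inverse of \<open>s\<close>, and \<open>h\<^sub>n\<close> for the sum of
  \<open>a\<^sup>i b\<^sup>j\<close> over \<open>i + j = n\<close>. If everything commuted, the left identity would be the partial
  fraction expansion of
  \<open>2 (2 s - a - b) / ((s - a)\<^sup>2 (s - b)) = 2 / (s - a)\<^sup>2 + 2 / ((s - a) (s - b))\<close>,
  whose summands have the expansions \<open>\<Sum> (n + 1) a\<^sup>n t\<^sup>n\<^sup>+\<^sup>2\<close> and \<open>\<Sum> h\<^sub>n t\<^sup>n\<^sup>+\<^sup>2\<close>.
  In the quaternions \<open>s\<close> need not commute with \<open>a\<close> and \<open>b\<close>, so multiplication by \<open>s - c\<close> is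
  replaced by the operator \<open>T\<^sub>c x = x s - c x\<close>. It suits series with coefficients on the left and
  powers of \<open>t\<close> on the right: it turns the generating series of a sequence with
  \<open>c\<^sub>n\<^sub>+\<^sub>1 = a c\<^sub>n + d\<^sub>n\<^sub>+\<^sub>1\<close> into that of \<open>d\<close> (\<open>sums_first_order_recurrence\<close>). The operators
  \<open>T\<^sub>a\<close> and \<open>T\<^sub>b\<close> commute, and since the trace \<open>a + b\<close> and the norm \<open>a b\<close> are real, \<open>T\<^sub>a T\<^sub>b\<close> is right
  multiplication by \<open>p = s\<^sup>2 - (a + b) s + a b\<close>, the quadratic polynomial in the kernels. With these
  rules the commutative computation goes through and evaluates the series times \<open>p\<^sup>2\<close>
  (\<open>kernel_series_times_square\<close>).

  Conjugation reverses products, exchanges \<open>q\<close> with its conjugate and carries \<open>F_L\<close> to \<open>F_R\<close>,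
  so the right identity is the conjugate of the left one. The expansion by Clifford-Appell
  polynomials agrees with the first one term by term; this follows by adding two recurrences
  for the unnormalised polynomials (\<open>kernel_coeff_eq_weighted_sums\<close>).
\<close>

section \<open>Sums of monomials in two commuting elements\<close>

definition homogeneous_sum :: "'a::semiring_1 \<Rightarrow> 'a \<Rightarrow> nat \<Rightarrow> 'a" where
  "homogeneous_sum a b n = (\<Sum>j\<le>n. a ^ (n - j) * b ^ j)"

text \<open>For \<open>b\<close> the conjugate of a quaternion \<open>a\<close> this is the Clifford-Appell polynomial without its
  normalising factor \<open>2 / ((n + 1) (n + 2))\<close>.\<close>

definition weighted_sum :: "'a::semiring_1 \<Rightarrow> 'a \<Rightarrow> nat \<Rightarrow> 'a" where
  "weighted_sum a b n = (\<Sum>j\<le>n. of_nat (n - j + 1) * a ^ (n - j) * b ^ j)"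

lemma homogeneous_sum_0 [simp]: "homogeneous_sum a b 0 = 1"
  by (simp add: homogeneous_sum_def)

lemma power_left_commute_if_commute:
  fixes a b :: "'a::monoid_mult"
  assumes "a * b = b * a"
  shows "a ^ i * (b * x) = b * (a ^ i * x)"
proof -
  have "a ^ i * b = b * a ^ i" using assms by (rule power_commuting_commutes)
  then show ?thesis by (simp only: mult.assoc [symmetric])
qed

lemma of_nat_left_commute: "of_nat k * (a * x) = a * (of_nat k * (x :: 'a::semiring_1))"
proof -
  have "of_nat k * a = a * of_nat k" by (rule mult_of_nat_commute)
  then show ?thesis by (simp only: mult.assoc [symmetric])
qed

lemma homogeneous_sum_Suc:
  assumes "a * b = b * a"
  shows "homogeneous_sum a b (Suc n) = b * homogeneous_sum a b n + a ^ Suc n"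
proof -
  have "a ^ i * (b * b ^ j) = b * (a ^ i * b ^ j)" for i j
    using assms by (rule power_left_commute_if_commute)
  then show ?thesis
    by (simp add: homogeneous_sum_def sum.atMost_Suc_shift sum_distrib_left add.commute
        del: sum.atMost_Suc)
qed

text \<open>This recurrence splits one copy of each monomial off its weight; the next one
  (\<open>weighted_sum_Suc_right\<close>) shifts the summation index and only sets the monomial without \<open>b\<close>
  apart. The parts of the two that do not involve the preceding sum add up to the coefficient
  \<open>kernel_coeff\<close> of the kernel series.\<close>

lemma weighted_sum_Suc_left:
  "weighted_sum a b (Suc n) = a * weighted_sum a b n + homogeneous_sum a b (Suc n)"
proof -
  have "of_nat (Suc n - j + 1) * a ^ (Suc n - j) * b ^ j
      = a * (of_nat (n - j + 1) * a ^ (n - j) * b ^ j) + a ^ (Suc n - j) * b ^ j"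
    if "j \<le> n" for j
  proof -
    have "of_nat (Suc i + 1) * (a * a ^ i) = a * (of_nat (i + 1) * a ^ i) + a * a ^ i" for i
      by (simp only: of_nat_left_commute[of _ a] distrib_left [symmetric])
        (simp add: distrib_right add.commute)
    from this[of "n - j"] show ?thesis
      using that by (simp only: Suc_diff_le power_Suc distrib_right mult.assoc)
  qed
  then show ?thesis
    by (simp add: weighted_sum_def homogeneous_sum_def sum_distrib_left sum.distrib add.assoc)
qed

lemma weighted_sum_Suc_right:
  assumes "a * b = b * a"
  shows "weighted_sum a b (Suc n) = b * weighted_sum a b n + of_nat (n + 2) * a ^ Suc n"
proof -
  have "of_nat k * a ^ i * (b * b ^ j) = b * (of_nat k * a ^ i * b ^ j)" for i j k
    by (simp only: mult.assoc power_left_commute_if_commute[OF assms] of_nat_left_commute[of k b])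
  then show ?thesis
    by (simp add: weighted_sum_def sum.atMost_Suc_shift sum_distrib_left add.commute
        del: sum.atMost_Suc of_nat_Suc of_nat_add)
qed

section \<open>Generating series with coefficients on the left\<close>

lemma norm_homogeneous_sum_le:
  fixes a b :: "'a::real_normed_div_algebra"
  assumes "norm b = norm a"
  shows "norm (homogeneous_sum a b n) \<le> real (Suc n) * norm a ^ n"
proof -
  have "norm (homogeneous_sum a b n) \<le> (\<Sum>j\<le>n. norm (a ^ (n - j) * b ^ j))"
    unfolding homogeneous_sum_def by (rule norm_sum)
  also have "\<dots> = (\<Sum>j\<le>n. norm a ^ n)"
    by (rule sum.cong) (simp_all add: norm_mult norm_power assms flip: power_add)
  finally show ?thesis by simp
qed

lemma summable_linear_growth_coefficients:
  fixes a s :: "'a::{real_normed_div_algebra,banach}"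
  assumes "norm a < norm s" and "\<And>n. norm (c n) \<le> real (Suc n) * norm a ^ n"
  shows "summable (\<lambda>n. c n * inverse s ^ (n + k))"
proof (rule summable_comparison_test')
  let ?r = "norm a / norm s"
  have "summable (\<lambda>n. of_nat (Suc n) * ?r ^ n)"
    using assms(1) geometric_deriv_sums[of ?r] le_less_trans[OF norm_ge_zero assms(1)]
    by (simp add: sums_iff)
  then show "summable (\<lambda>n. (real (Suc n) * ?r ^ n) * inverse (norm s) ^ k)"
    by (intro summable_mult2) simp
  fix n :: nat
  have "norm (c n * inverse s ^ (n + k)) = norm (c n) * inverse (norm s) ^ (n + k)"
    by (simp add: norm_mult norm_power norm_inverse)
  also have "\<dots> \<le> (real (Suc n) * norm a ^ n) * inverse (norm s) ^ (n + k)"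
    by (intro mult_right_mono assms(2)) simp
  also have "\<dots> = (real (Suc n) * ?r ^ n) * inverse (norm s) ^ k"
    by (simp add: power_add divide_inverse power_mult_distrib)
  finally show "norm (c n * inverse s ^ (n + k)) \<le> \<dots>" .
qed

text \<open>Multiplying the series by \<open>s\<close> from the right lowers each exponent by one, while multiplying by
  \<open>a\<close> from the left acts on the coefficients only. So the difference of
  the two compares \<open>c (Suc n)\<close> with \<open>a * c n\<close> at the same power of \<open>inverse s\<close>, and \<open>a\<close> and \<open>s\<close> never have to be exchanged.\<close>

lemma sums_first_order_recurrence:
  fixes a s :: "'a::real_normed_div_algebra"
  assumes "s \<noteq> 0" and c: "(\<lambda>n. c n * inverse s ^ (n + Suc k)) sums G"
    and "d 0 = c 0" and rec: "\<And>n. c (Suc n) = a * c n + d (Suc n)"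
  shows "(\<lambda>n. d n * inverse s ^ (n + k)) sums (G * s - a * G)"
proof -
  have "(\<lambda>n. c n * inverse s ^ (n + Suc k) * s) sums (G * s)"
    using c by (rule sums_mult2)
  moreover have "c n * inverse s ^ (n + Suc k) * s = c n * inverse s ^ (n + k)" for n
    using \<open>s \<noteq> 0\<close> by (simp only: add_Suc_right power_Suc2 mult.assoc) simp
  ultimately have "(\<lambda>n. c n * inverse s ^ (n + k)) sums (G * s)" by simp
  then have "(\<lambda>n. c (Suc n) * inverse s ^ (Suc n + k)) sums (G * s - c 0 * inverse s ^ k)"
    using sums_Suc_iff[of "\<lambda>n. c n * inverse s ^ (n + k)"] by simp
  from sums_diff[OF this sums_mult[OF c, of a]]
  have "(\<lambda>n. d (Suc n) * inverse s ^ (Suc n + k)) sums (G * s - c 0 * inverse s ^ k - a * G)"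
    by (simp add: rec algebra_simps)
  then have "(\<lambda>n. d n * inverse s ^ (n + k)) sums
      (G * s - c 0 * inverse s ^ k - a * G + d 0 * inverse s ^ (0 + k))"
    by (rule sums_Suc)
  then show ?thesis by (simp add: \<open>d 0 = c 0\<close>)
qed

definition kernel_coeff :: "'a::semiring_1 \<Rightarrow> 'a \<Rightarrow> nat \<Rightarrow> 'a" where
  "kernel_coeff a b n = of_nat (Suc n) * a ^ n + homogeneous_sum a b n"

lemma of_real_commute: "x * of_real r = of_real r * (x :: 'a::real_algebra_1)"
  by (simp add: of_real_def)

text \<open>The assumptions on \<open>a + b\<close> and \<open>a * b\<close> are those satisfied by a quaternion and its
  conjugate. They make the two symmetric functions central, so that the operators \<open>T a\<close> and \<open>T b\<close>
  of the proof compose to multiplication by \<open>p\<close>. Since \<open>p\<close> need not commute with \<open>s - b\<close>, the value of the series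
  is given through its product with \<open>p\<^sup>2\<close> on the right; dividing is left to the kernels.\<close>

lemma kernel_series_times_square:
  fixes a b s :: "'a::{real_normed_div_algebra,banach}"
  assumes "norm a < norm s" and "norm b = norm a"
    and trace: "a + b = of_real u" and norm: "a * b = of_real v"
  defines "p \<equiv> s\<^sup>2 - of_real u * s + of_real v"
  shows "p \<noteq> 0"
    and "\<exists>S. (\<lambda>n. kernel_coeff a b n * inverse s ^ (n + 2)) sums S
           \<and> S * p\<^sup>2 = (s - b) * (2 * s - of_real u)"
proof -
  let ?t = "inverse s"
  have s: "s \<noteq> 0" using assms(1) by auto
  \<comment> \<open>The substitute for multiplication by \<open>s - c\<close> in the commutative computation.\<close>
  define T where "T c x = x * s - c * x" for c x :: 'a
  have b: "b = of_real u - a" using trace by (metis add_diff_cancel_left')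
  have comm: "a * b = b * a"
    by (simp add: b algebra_simps of_real_commute)
  have T_comm: "T a (T b x) = T b (T a x)" for x
  proof -
    have "a * (b * x) = b * (a * x)" by (metis comm mult.assoc)
    then show ?thesis by (simp add: T_def algebra_simps)
  qed
  have T_add: "T a x + T b x = x * (2 * s - of_real u)" for x
  proof -
    have "a * x + b * x = x * of_real u"
      by (metis distrib_right trace of_real_commute)
    then show ?thesis by (simp add: T_def algebra_simps mult_2)
  qed
  have T_T: "T a (T b x) = x * p" for x
  proof -
    have "a * (x * s) + b * (x * s) = x * (of_real u * s)"
      by (metis distrib_right trace of_real_commute mult.assoc)
    moreover have "a * (b * x) = x * of_real v"
      by (metis norm of_real_commute mult.assoc)
    ultimately show ?thesis
      by (simp add: T_def p_def algebra_simps power2_eq_square)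
  qed
  have "p * s = s * p"
    by (simp add: p_def algebra_simps power2_eq_square)
      (metis of_real_commute mult.assoc)
  then have T_p: "T c (x * p) = T c x * p" for c x
    by (simp add: T_def algebra_simps)
  \<comment> \<open>The three series stand for \<open>1 / (s - a)\<close>, \<open>1 / (s - a)\<^sup>2\<close> and \<open>1 / ((s - a) (s - b))\<close>.\<close>
  have "summable (\<lambda>n. a ^ n * ?t ^ (n + 1))"
    using \<open>norm a < norm s\<close>
    by (rule summable_linear_growth_coefficients) (simp add: norm_power mult_le_cancel_right1)
  then obtain G1 where G1: "(\<lambda>n. a ^ n * ?t ^ (n + Suc 0)) sums G1"
    by (auto simp: summable_def)
  have "summable (\<lambda>n. of_nat (Suc n) * a ^ n * ?t ^ (n + 2))"
    using \<open>norm a < norm s\<close>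
    by (rule summable_linear_growth_coefficients)
      (simp add: norm_mult norm_power del: of_nat_Suc)
  then obtain G2 where G2: "(\<lambda>n. of_nat (Suc n) * a ^ n * ?t ^ (n + Suc 1)) sums G2"
    by (auto simp: summable_def)
  have "summable (\<lambda>n. homogeneous_sum a b n * ?t ^ (n + 2))"
    using \<open>norm a < norm s\<close> norm_homogeneous_sum_le[OF \<open>norm b = norm a\<close>]
    by (rule summable_linear_growth_coefficients)
  then obtain G3 where G3: "(\<lambda>n. homogeneous_sum a b n * ?t ^ (n + Suc 1)) sums G3"
    by (auto simp: summable_def)
  \<comment> \<open>The coefficients obey recurrences whose inhomogeneous parts are the unit sequence for \<open>G1\<close>
      and the powers of \<open>a\<close> for \<open>G2\<close> and \<open>G3\<close>.\<close>
  have "(\<lambda>n. (if n = 0 then 1 else 0) * ?t ^ (n + 0)) sums T a G1"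
    unfolding T_def by (rule sums_first_order_recurrence[OF s G1]) simp_all
  moreover have "(\<lambda>n. (if n = 0 then 1 else 0) * ?t ^ (n + 0)) sums 1"
    using sums_single[of 0 "\<lambda>_. 1 :: 'a"]
    by (rule sums_cong[THEN iffD1, rotated]) auto
  ultimately have T_G1: "T a G1 = 1"
    by (rule sums_unique2)
  have "(\<lambda>n. a ^ n * ?t ^ (n + 1)) sums T a G2"
    unfolding T_def
    by (rule sums_first_order_recurrence[OF s G2])
      (simp_all add: algebra_simps mult_of_nat_commute)
  then have T_G2: "T a G2 = G1"
    using G1 by (simp add: sums_unique2)
  have "(\<lambda>n. a ^ n * ?t ^ (n + 1)) sums T b G3"
    unfolding T_def
    by (rule sums_first_order_recurrence[OF s G3]) (simp_all add: homogeneous_sum_Suc comm)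
  then have T_G3: "T b G3 = G1"
    using G1 by (simp add: sums_unique2)
  have G1_p: "G1 * p = s - b"
    unfolding T_T[symmetric] by (simp add: T_comm T_G1) (simp add: T_def)
  \<comment> \<open>Otherwise \<open>s = b\<close>, although \<open>norm b < norm s\<close>.\<close>
  show "p \<noteq> 0"
    using G1_p assms(1,2) by auto
  have "(G2 + G3) * p\<^sup>2 = (G2 * p) * p + (G3 * p) * p"
    by (simp add: algebra_simps power2_eq_square)
  also have "\<dots> = T b G1 * p + T a G1 * p"
    by (metis T_T T_comm T_G2 T_G3)
  also have "\<dots> = T a (s - b) + T b (s - b)"
    by (metis T_p G1_p add.commute)
  finally have "(G2 + G3) * p\<^sup>2 = (s - b) * (2 * s - of_real u)"
    by (simp add: T_add)
  moreover have "(\<lambda>n. kernel_coeff a b n * ?t ^ (n + 2)) sums (G2 + G3)"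
    using sums_add[OF G2 G3] by (simp add: kernel_coeff_def algebra_simps)
  ultimately show "\<exists>S. (\<lambda>n. kernel_coeff a b n * ?t ^ (n + 2)) sums S
           \<and> S * p\<^sup>2 = (s - b) * (2 * s - of_real u)"
    by blast
qed

section \<open>Completeness and conjugation of the quaternions\<close>

lemma quat_components_numeral [simp]:
  "qRe (numeral n) = numeral n" "qIm1 (numeral n) = 0" "qIm2 (numeral n) = 0" "qIm3 (numeral n) = 0"
  using qRe_of_real[of "numeral n"] qIm1_of_real[of "numeral n"] qIm2_of_real[of "numeral n"]
    qIm3_of_real[of "numeral n"] by (simp_all del: qRe_of_real qIm1_of_real qIm2_of_real qIm3_of_real)

lemma quat_components_of_nat [simp]:
  "qRe (of_nat n) = of_nat n" "qIm1 (of_nat n) = 0" "qIm2 (of_nat n) = 0" "qIm3 (of_nat n) = 0"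
  using qRe_of_real[of "of_nat n"] qIm1_of_real[of "of_nat n"] qIm2_of_real[of "of_nat n"]
    qIm3_of_real[of "of_nat n"] by (simp_all del: qRe_of_real qIm1_of_real qIm2_of_real qIm3_of_real)

lemma norm_quat_le_sum: "norm x \<le> \<bar>qRe x\<bar> + \<bar>qIm1 x\<bar> + \<bar>qIm2 x\<bar> + \<bar>qIm3 x\<bar>"
proof -
  have "norm x = norm (qRe x, qIm1 x, qIm2 x, qIm3 x)"
    by (simp add: norm_quat_def norm_Pair add.assoc)
  also have "\<dots> \<le> \<bar>qRe x\<bar> + (\<bar>qIm1 x\<bar> + (\<bar>qIm2 x\<bar> + \<bar>qIm3 x\<bar>))"
    using norm_Pair_le[of "qRe x" "(qIm1 x, qIm2 x, qIm3 x)"]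
      norm_Pair_le[of "qIm1 x" "(qIm2 x, qIm3 x)"] norm_Pair_le[of "qIm2 x" "qIm3 x"]
    unfolding real_norm_def by linarith
  finally show ?thesis by simp
qed

lemma bounded_linear_quat_components:
  "bounded_linear qRe" "bounded_linear qIm1" "bounded_linear qIm2" "bounded_linear qIm3"
  by (rule bounded_linear_intro[where K = 1];
      simp add: norm_quat_def real_le_rsqrt)+

text \<open>Completeness is what allows convergence of the series to be read off from their norms.\<close>

instance quat :: banach
proof
  fix X :: "nat \<Rightarrow> quat"
  assume "Cauchy X"
  then obtain a b c d where lim: "(\<lambda>n. qRe (X n)) \<longlonglongrightarrow> a" "(\<lambda>n. qIm1 (X n)) \<longlonglongrightarrow> b"
      "(\<lambda>n. qIm2 (X n)) \<longlonglongrightarrow> c" "(\<lambda>n. qIm3 (X n)) \<longlonglongrightarrow> d"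
    using bounded_linear_quat_components[THEN bounded_linear.Cauchy]
    by (meson Cauchy_convergent convergentD)
  have "(\<lambda>n. X n - Quat a b c d) \<longlonglongrightarrow> 0"
  proof (rule Lim_null_comparison)
    show "\<forall>\<^sub>F n in sequentially. norm (X n - Quat a b c d)
        \<le> \<bar>qRe (X n) - a\<bar> + \<bar>qIm1 (X n) - b\<bar> + \<bar>qIm2 (X n) - c\<bar> + \<bar>qIm3 (X n) - d\<bar>"
      using norm_quat_le_sum[of "X _ - Quat a b c d"] by simp
    show "(\<lambda>n. \<bar>qRe (X n) - a\<bar> + \<bar>qIm1 (X n) - b\<bar> + \<bar>qIm2 (X n) - c\<bar> + \<bar>qIm3 (X n) - d\<bar>)
        \<longlonglongrightarrow> 0"
      using lim by (auto intro!: tendsto_eq_intros)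
  qed
  then show "convergent X"
    by (auto simp: convergent_def LIM_zero_iff)
qed

lemma qcnj_mult: "qcnj (x * y) = qcnj y * qcnj x"
  and qcnj_add: "qcnj (x + y) = qcnj x + qcnj y"
  and qcnj_diff: "qcnj (x - y) = qcnj x - qcnj y"
  and qcnj_minus: "qcnj (- x) = - qcnj x"
  and qcnj_of_real: "qcnj (of_real r) = of_real r"
  and qcnj_scaleR: "qcnj (scaleR r x) = scaleR r (qcnj x)"
  and qcnj_zero: "qcnj 0 = 0"
  and qcnj_one: "qcnj 1 = 1"
  and qcnj_qcnj: "qcnj (qcnj x) = x"
  and norm_qcnj: "norm (qcnj x) = norm x"
  by (simp_all add: quat_eq_iff norm_quat_def)

lemma qcnj_of_nat: "qcnj (of_nat n) = of_nat n"
  using qcnj_of_real[of "of_nat n"] by simp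

lemma qcnj_numeral: "qcnj (numeral n) = numeral n"
  using qcnj_of_real[of "numeral n"] by simp

lemma qcnj_power: "qcnj (x ^ n) = qcnj x ^ n"
  by (induction n) (simp_all add: qcnj_one qcnj_mult power_commutes)

lemma qcnj_inverse: "qcnj (inverse x) = inverse (qcnj x)"
  by (simp add: inverse_quat_def qcnj_scaleR)

lemma qcnj_sum: "qcnj (sum f A) = (\<Sum>x\<in>A. qcnj (f x))"
  by (induction A rule: infinite_finite_induct) (simp_all add: qcnj_zero qcnj_add)

lemma bounded_linear_qcnj: "bounded_linear qcnj"
  by (rule bounded_linear_intro[where K = 1])
    (simp_all add: qcnj_add qcnj_scaleR norm_qcnj)

lemmas qcnj_simps = qcnj_mult qcnj_add qcnj_diff qcnj_minus qcnj_of_real qcnj_one qcnj_qcnj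
  qcnj_of_nat qcnj_numeral qcnj_power qcnj_inverse qcnj_sum

section \<open>The kernels as series\<close>

lemma add_qcnj: "q + qcnj q = of_real (2 * qRe q)"
  by (simp add: quat_eq_iff del: of_real_mult)

lemma qcnj_commute: "q * qcnj q = qcnj q * q"
  by (simp add: quat_eq_iff algebra_simps)

lemma powi_minus_two: "(x :: 'a::division_ring) powi (-2) = inverse (x\<^sup>2)"
  by (simp add: power_int_def power_inverse)

lemma kernel_series_left:
  assumes "norm q < norm s"
  shows "\<exists>S. (\<lambda>n. kernel_coeff q (qcnj q) n * inverse s ^ (n + 2)) sums S
    \<and> 2 * S = F_L s q * (of_real (qRe q) - s)"
proof -
  define p where "p = s\<^sup>2 - of_real (2 * qRe q) * s + of_real ((norm q)\<^sup>2)"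
  note series = kernel_series_times_square[OF assms norm_qcnj add_qcnj quat_mult_qcnj,
      folded p_def]
  obtain S where S: "(\<lambda>n. kernel_coeff q (qcnj q) n * inverse s ^ (n + 2)) sums S"
      "S * p\<^sup>2 = (s - qcnj q) * (2 * s - of_real (2 * qRe q))"
    using series(2) by blast
  have "p * s = s * p"
    by (simp add: p_def quat_eq_iff power2_eq_square algebra_simps)
  then have "p * (of_real (qRe q) - s) = (of_real (qRe q) - s) * p"
    by (simp add: left_diff_distrib right_diff_distrib of_real_commute)
  then have comm: "(of_real (qRe q) - s) * inverse (p\<^sup>2) = inverse (p\<^sup>2) * (of_real (qRe q) - s)"
    by (metis mult_commute_imp_mult_inverse_commute power_commuting_commutes)
  have "S = S * p\<^sup>2 * inverse (p\<^sup>2)"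
    using series(1) by (simp add: mult.assoc)
  also have "\<dots> = (s - qcnj q) * (-2 * (of_real (qRe q) - s)) * inverse (p\<^sup>2)"
  proof -
    have "2 * s - of_real (2 * qRe q) = - 2 * (of_real (qRe q) - s)"
      by (simp add: quat_eq_iff)
    then show ?thesis unfolding S(2) by simp
  qed
  finally have S_eq: "S = (s - qcnj q) * (-2 * (of_real (qRe q) - s)) * inverse (p\<^sup>2)" .
  have "2 * x = scaleR 2 x" "- 2 * x = scaleR (- 2) x" "- 4 * x = scaleR (- 4) x" for x :: quat
    by (simp_all add: quat_eq_iff)
  then have "2 * S = - 4 * (s - qcnj q) * ((of_real (qRe q) - s) * inverse (p\<^sup>2))"
    unfolding S_eq by (simp only: mult_scaleR_left mult_scaleR_right mult.assoc scaleR_scaleR) simp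
  also have "\<dots> = F_L s q * (of_real (qRe q) - s)"
    unfolding comm by (simp add: F_L_def p_def powi_minus_two mult.assoc)
  finally show ?thesis using S(1) by blast
qed

lemma qcnj_F_L: "qcnj (F_L (qcnj s) (qcnj q)) = F_R s q"
proof -
  have "qcnj (F_L (qcnj s) (qcnj q))
      = inverse ((s\<^sup>2 - s * (of_real (qRe q) * 2) + of_real ((norm q)\<^sup>2))\<^sup>2) * ((s - qcnj q) * - 4)"
    by (simp add: F_L_def powi_minus_two qcnj_simps norm_qcnj del: of_real_power)
  also have "s * (of_real (qRe q) * 2) = 2 * of_real (qRe q) * s"
    by (simp add: quat_eq_iff)
  also have "x * (y * - 4) = - 4 * x * y" for x y :: quat
    by (simp add: quat_eq_iff)
  finally show ?thesis
    by (simp add: F_R_def powi_minus_two)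
qed

text \<open>Conjugation undoes the exchange of \<open>q\<close> with its conjugate, and it reverses the order of the
  factors in each monomial, which is harmless because \<open>q\<close> and its conjugate commute.\<close>

lemma qcnj_kernel_coeff: "qcnj (kernel_coeff (qcnj q) q n) = kernel_coeff q (qcnj q) n"
proof -
  have "q ^ j * qcnj q ^ i = qcnj q ^ i * q ^ j" for i j
    by (metis qcnj_commute power_commuting_commutes)
  then show ?thesis
    by (simp add: kernel_coeff_def homogeneous_sum_def qcnj_simps mult_of_nat_commute
        del: of_nat_Suc)
qed

text \<open>This is the conjugate of the left expansion at the conjugates of \<open>s\<close> and \<open>q\<close>.\<close>

lemma kernel_series_right:
  assumes "norm q < norm s"
  shows "\<exists>S. (\<lambda>n. inverse s ^ (n + 2) * kernel_coeff q (qcnj q) n) sums S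
    \<and> 2 * S = (of_real (qRe q) - s) * F_R s q"
proof -
  obtain S where
      S: "(\<lambda>n. kernel_coeff (qcnj q) q n * inverse (qcnj s) ^ (n + 2)) sums S"
        "2 * S = F_L (qcnj s) (qcnj q) * (of_real (qRe q) - qcnj s)"
    using kernel_series_left[of "qcnj q" "qcnj s"] assms by (auto simp: norm_qcnj qcnj_qcnj)
  have "(\<lambda>n. inverse s ^ (n + 2) * kernel_coeff q (qcnj q) n) sums qcnj S"
    using bounded_linear.sums[OF bounded_linear_qcnj S(1)]
    by (simp add: qcnj_simps qcnj_kernel_coeff del: power_Suc)
  moreover have "2 * qcnj S = (of_real (qRe q) - s) * F_R s q"
    using arg_cong[OF S(2), of qcnj]
    by (simp add: qcnj_F_L qcnj_simps) (simp add: quat_eq_iff)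
  ultimately show ?thesis by blast
qed

section \<open>The coefficients as Clifford-Appell polynomials\<close>

text \<open>The sum of the left and the right recurrence for \<open>weighted_sum\<close>. Its use for quaternions
  rests on \<open>a + b\<close> being twice the real part.\<close>

lemma kernel_coeff_eq_weighted_sums:
  fixes a b :: "'a::ring_1"
  assumes "a * b = b * a"
  shows "kernel_coeff a b (Suc n) = 2 * weighted_sum a b (Suc n) - (a + b) * weighted_sum a b n"
proof -
  let ?w = "weighted_sum a b"
  have "?w (Suc n) = a * ?w n + homogeneous_sum a b (Suc n)"
    by (rule weighted_sum_Suc_left)
  moreover have "?w (Suc n) = b * ?w n + of_nat (Suc (Suc n)) * a ^ Suc n"
    using weighted_sum_Suc_right[OF assms, of n] by (simp only: add_2_eq_Suc')
  ultimately have "2 * ?w (Suc n)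
      = (a * ?w n + homogeneous_sum a b (Suc n)) + (b * ?w n + of_nat (Suc (Suc n)) * a ^ Suc n)"
    unfolding mult_2 by (rule arg_cong2)
  also have "\<dots> = (a + b) * ?w n + kernel_coeff a b (Suc n)"
    unfolding kernel_coeff_def distrib_right by (simp only: ac_simps)
  finally show ?thesis by (simp only: add_diff_cancel_left')
qed

lemma Clifford_Appell_of_nat:
  "of_real ((real n + 1) * (real n + 2)) * Clifford_Appell (int n) q = 2 * weighted_sum q (qcnj q) n"
proof -
  define c where "c = (real n + 1) * (real n + 2)"
  have "c \<noteq> 0" by (simp add: c_def)
  have "Clifford_Appell (int n) q = of_real (2 / c) * weighted_sum q (qcnj q) n"
    unfolding Clifford_Appell_def weighted_sum_def c_def atLeast0AtMost of_int_of_nat_eq nat_int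
    by (simp only: of_nat_less_0_iff if_False)
  then have "of_real c * Clifford_Appell (int n) q = of_real (c * (2 / c)) * weighted_sum q (qcnj q) n"
    by (simp only: of_real_mult mult.assoc)
  also have "c * (2 / c) = 2" using \<open>c \<noteq> 0\<close> by simp
  finally show ?thesis by (simp only: c_def of_real_numeral)
qed

text \<open>The prefactors \<open>n (n + 1)\<close> and \<open>n (n - 1)\<close> cancel the normalisations of the polynomials of
  degrees \<open>n - 1\<close> and \<open>n - 2\<close>; here \<open>n\<close> is the successor of the index of \<open>kernel_coeff\<close>.\<close>

lemma kernel_coeff_eq_Clifford_Appell:
  "kernel_coeff q (qcnj q) n = (\<Sum>j = 0..1::nat. of_nat (Suc n) * of_real (qRe q) ^ j * (- 1) ^ j
      * of_int (int (Suc n) + 1 - 2 * int j) * Clifford_Appell (int (Suc n) - 1 - int j) q)"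
proof (cases n)
  case 0
  then show ?thesis
    by (simp add: kernel_coeff_def Clifford_Appell_def)
next
  case (Suc m)
  have *: "2 * weighted_sum q (qcnj q) m = of_nat (Suc m) * of_nat (m + 2) * Clifford_Appell (int m) q" for m
  proof -
    have "of_real ((real m + 1) * (real m + 2)) = (of_nat (Suc m) * of_nat (m + 2) :: quat)"
      by (simp add: quat_eq_iff algebra_simps)
    then show ?thesis by (simp only: Clifford_Appell_of_nat[symmetric])
  qed
  have "kernel_coeff q (qcnj q) n = 2 * weighted_sum q (qcnj q) (Suc m)
      - of_real (qRe q) * (2 * weighted_sum q (qcnj q) m)"
    unfolding Suc kernel_coeff_eq_weighted_sums[OF qcnj_commute] add_qcnj
    by (simp add: quat_eq_iff)
  then show ?thesis
    unfolding * using Suc by (simp add: quat_eq_iff algebra_simps)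
qed

section \<open>The expansions of the kernels\<close>

theorem lemma5p6:
  fixes q s :: quat
  assumes "norm q < norm s"
  defines "A \<equiv> \<lambda>n::nat.
      (of_nat n * q ^ (n - 1) + (\<Sum>j = 1..n. q ^ (n - j) * qcnj q ^ (j - 1)))
        * s powi (- 1 - int n)"
    and "B \<equiv> \<lambda>n::nat. \<Sum>j = 0..1::nat.
      of_nat n * of_real (qRe q) ^ j * (- 1) ^ j * of_int (int n + 1 - 2 * int j)
        * Clifford_Appell (int n - 1 - int j) q * s powi (- 1 - int n)"
    and "C \<equiv> \<lambda>n::nat. s powi (- 1 - int n)
        * (of_nat n * q ^ (n - 1) + (\<Sum>k = 1..n. q ^ (n - k) * qcnj q ^ (k - 1)))"
    and "D \<equiv> \<lambda>n::nat. \<Sum>j = 0..1::nat.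
      of_nat n * s powi (- 1 - int n) * of_real (qRe q) ^ j * (- 1) ^ j
        * of_int (int n + 1 - 2 * int j) * Clifford_Appell (int n - 1 - int j) q"
  shows "summable (\<lambda>m. A (Suc m)) \<and> summable (\<lambda>m. B (Suc m)) \<and>
      (\<Sum>k = 0..1::nat. of_real (qRe q) ^ k * F_L s q * (- 1) ^ (k + 1) * s ^ (1 - k))
        = 2 * (\<Sum>m. A (Suc m)) \<and>
      2 * (\<Sum>m. A (Suc m)) = 2 * (\<Sum>m. B (Suc m)) \<and>
      summable (\<lambda>m. C (Suc m)) \<and> summable (\<lambda>m. D (Suc m)) \<and>
      (\<Sum>k = 0..1::nat. s ^ (1 - k) * (- 1) ^ (k + 1) * F_R s q * of_real (qRe q) ^ k)
        = 2 * (\<Sum>m. C (Suc m)) \<and>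
      2 * (\<Sum>m. C (Suc m)) = 2 * (\<Sum>m. D (Suc m))"
proof -
  let ?N = "kernel_coeff q (qcnj q)"
  let ?t = "inverse s"
  have powi: "s powi (- 1 - int (Suc m)) = ?t ^ (m + 2)" for m
  proof -
    have "- 1 - int (Suc m) = - int (m + 2)" by simp
    then show ?thesis by (simp only: power_int_minus power_int_of_nat power_inverse)
  qed
  have coeff: "of_nat (Suc m) * q ^ (Suc m - 1) + (\<Sum>j = 1..Suc m. q ^ (Suc m - j) * qcnj q ^ (j - 1))
      = ?N m" for m
  proof -
    have "(\<Sum>j = 1..Suc m. q ^ (Suc m - j) * qcnj q ^ (j - 1)) = homogeneous_sum q (qcnj q) m"
      unfolding homogeneous_sum_def
      by (rule sum.reindex_bij_witness[where i = Suc and j = "\<lambda>j. j - 1"]) auto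
    then show ?thesis by (simp add: kernel_coeff_def)
  qed
  have A: "A (Suc m) = ?N m * ?t ^ (m + 2)" for m
    unfolding A_def coeff powi ..
  have B: "B (Suc m) = ?N m * ?t ^ (m + 2)" for m
    unfolding B_def powi kernel_coeff_eq_Clifford_Appell by (rule sum_distrib_right [symmetric])
  have C: "C (Suc m) = ?t ^ (m + 2) * ?N m" for m
    unfolding C_def coeff powi ..
  have D: "D (Suc m) = ?t ^ (m + 2) * ?N m" for m
    unfolding D_def powi kernel_coeff_eq_Clifford_Appell sum_distrib_left
    by (rule sum.cong) (simp_all only: mult.assoc mult_of_nat_commute)
  obtain S where S: "(\<lambda>m. ?N m * ?t ^ (m + 2)) sums S" "2 * S = F_L s q * (of_real (qRe q) - s)"
    using kernel_series_left[OF assms(1)] by blast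
  obtain S' where S': "(\<lambda>m. ?t ^ (m + 2) * ?N m) sums S'" "2 * S' = (of_real (qRe q) - s) * F_R s q"
    using kernel_series_right[OF assms(1)] by blast
  have "(\<Sum>k = 0..1::nat. of_real (qRe q) ^ k * F_L s q * (- 1) ^ (k + 1) * s ^ (1 - k))
      = F_L s q * (of_real (qRe q) - s)"
    by (simp add: right_diff_distrib of_real_commute)
  moreover have "(\<Sum>k = 0..1::nat. s ^ (1 - k) * (- 1) ^ (k + 1) * F_R s q * of_real (qRe q) ^ k)
      = (of_real (qRe q) - s) * F_R s q"
    by (simp add: left_diff_distrib of_real_commute)
  ultimately show ?thesis
    using S S' by (simp only: A B C D sums_iff)
qed

end
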